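(* For integers $d,k\geq 1$ and $b\geq 0$, let $f_{b,k}(d)$ be the number of combinatorial types (isomorphism classes) of $k$-skeleta of $(d-1)$-dimensional flag homology spheres (over a fixed field $\mathbb{K}$) with $\gamma_1=b$. Then for every $b$ and $k$ there is a constant $c_{b,k}$ such that $f_{b,k}(d)\leq c_{b,k}$ for all $d\geq 1$.
   Context: A simplicial complex is a finite family of subsets (faces) of a finite vertex set, closed under subsets, with every vertex a face; pure of dimension $d-1$ if all maximal faces have $d$ elements. The $k$-skeleton is the subcomplex of faces of dimension at most $k$ (i.e. at most $k+1$ elements). Link: $\mathrm{lk}_\Delta(f)=\{g\in\Delta:g\cap f=\emptyset,\ g\cup f\in\Delta\}$. A $(d-1)$-dimensional homology sphere over $\mathbb{K}$ is a pure $(d-1)$-dimensional complex such that for every face $f$ (including $\emptyset$), $\tilde H_i(\mathrm{lk}_\Delta(f);\mathbb{K})$ is $0$ for $i<d-1-|f|$ and $\mathbb{K}$ for $i=d-1-|f|$. Flag: every minimal non-face has two elements. For a $(d-1)$-dimensional homology sphere, $\gamma_1=f_1-2d$ where $f_1$ is its number of vertices. *)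

theory Defs
  imports Main
begin

section \<open>Simplicial complexes\<close>

text \<open>
  A complex is given by its family of faces, the empty face included. Since every vertex is
  a face, the vertex set is recovered as the union of the faces.
\<close>

definition simplicial_complex :: "'v set set \<Rightarrow> bool" where
  "simplicial_complex \<Delta> \<longleftrightarrow>
     finite \<Delta> \<and> (\<forall>\<sigma>\<in>\<Delta>. finite \<sigma>) \<and> {} \<in> \<Delta> \<and> (\<forall>\<sigma>\<in>\<Delta>. \<forall>\<tau>. \<tau> \<subseteq> \<sigma> \<longrightarrow> \<tau> \<in> \<Delta>)"

abbreviation vertices :: "'v set set \<Rightarrow> 'v set" where
  "vertices \<Delta> \<equiv> \<Union>\<Delta>"

definition facet :: "'v set set \<Rightarrow> 'v set \<Rightarrow> bool" where
  "facet \<Delta> \<sigma> \<longleftrightarrow> \<sigma> \<in> \<Delta> \<and> (\<forall>\<tau>\<in>\<Delta>. \<sigma> \<subseteq> \<tau> \<longrightarrow> \<tau> = \<sigma>)"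

text \<open>Purity of dimension $d - 1$, with the parameter $d$ being the size of a facet.\<close>

definition pure_of_rank :: "nat \<Rightarrow> 'v set set \<Rightarrow> bool" where
  "pure_of_rank d \<Delta> \<longleftrightarrow> (\<forall>\<sigma>. facet \<Delta> \<sigma> \<longrightarrow> card \<sigma> = d)"

definition skeleton :: "nat \<Rightarrow> 'v set set \<Rightarrow> 'v set set" where
  "skeleton k \<Delta> = {\<sigma> \<in> \<Delta>. card \<sigma> \<le> k + 1}"

definition link :: "'v set set \<Rightarrow> 'v set \<Rightarrow> 'v set set" where
  "link \<Delta> \<sigma> = {\<tau> \<in> \<Delta>. \<tau> \<inter> \<sigma> = {} \<and> \<tau> \<union> \<sigma> \<in> \<Delta>}"

definition minimal_nonface :: "'v set set \<Rightarrow> 'v set \<Rightarrow> bool" where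
  "minimal_nonface \<Delta> \<sigma> \<longleftrightarrow> \<sigma> \<subseteq> vertices \<Delta> \<and> \<sigma> \<notin> \<Delta> \<and> (\<forall>\<tau>. \<tau> \<subset> \<sigma> \<longrightarrow> \<tau> \<in> \<Delta>)"

definition flag :: "'v set set \<Rightarrow> bool" where
  "flag \<Delta> \<longleftrightarrow> (\<forall>\<sigma>. minimal_nonface \<Delta> \<sigma> \<longrightarrow> card \<sigma> = 2)"

section \<open>Reduced simplicial homology with field coefficients\<close>

text \<open>
  Dimensions are integers, so that the empty face spans the chains of dimension $-1$ and there
  are no nonzero chains below that. Simplices are oriented by the order of the vertices.
\<close>

definition chains :: "'v set set \<Rightarrow> int \<Rightarrow> ('v set \<Rightarrow> 'k::field) set" where
  "chains \<Delta> i = {c. \<forall>\<sigma>. c \<sigma> \<noteq> 0 \<longrightarrow> \<sigma> \<in> \<Delta> \<and> int (card \<sigma>) = i + 1}"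

text \<open>
  The boundary of the oriented simplex $[v_0 < \dots < v_n]$ is the alternating sum of the
  simplices obtained by deleting $v_j$ with sign $(-1)^j$. The definition gives the coefficient
  of \<open>\<tau>\<close> in the boundary of \<open>c\<close>: the simplices with \<open>\<tau>\<close> as a codimension-one
  face are the sets \<open>insert v \<tau>\<close>, and \<open>v\<close> has \<open>card {w \<in> \<tau>. w < v}\<close> predecessors there.
\<close>

definition boundary :: "'v::linorder set set \<Rightarrow> ('v set \<Rightarrow> 'k::field) \<Rightarrow> 'v set \<Rightarrow> 'k" where
  "boundary \<Delta> c = (\<lambda>\<tau>. \<Sum>v \<in> vertices \<Delta> - \<tau>. (-1) ^ card {w \<in> \<tau>. w < v} * c (insert v \<tau>))"

definition cycles :: "'v::linorder set set \<Rightarrow> int \<Rightarrow> ('v set \<Rightarrow> 'k::field) set" where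
  "cycles \<Delta> i = {c \<in> chains \<Delta> i. boundary \<Delta> c = (\<lambda>_. 0)}"

definition boundaries :: "'v::linorder set set \<Rightarrow> int \<Rightarrow> ('v set \<Rightarrow> 'k::field) set" where
  "boundaries \<Delta> i = boundary \<Delta> ` chains \<Delta> (i + 1)"

definition homology_class ::
    "'v::linorder set set \<Rightarrow> int \<Rightarrow> ('v set \<Rightarrow> 'k::field) \<Rightarrow> ('v set \<Rightarrow> 'k) set" where
  "homology_class \<Delta> i x = {y \<in> cycles \<Delta> i. (\<lambda>\<sigma>. y \<sigma> - x \<sigma>) \<in> boundaries \<Delta> i}"

definition reduced_homology ::
    "'v::linorder set set \<Rightarrow> int \<Rightarrow> ('v set \<Rightarrow> 'k::field) set set" where
  "reduced_homology \<Delta> i = homology_class \<Delta> i ` cycles \<Delta> i"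

definition homology_zero :: "'k::field itself \<Rightarrow> 'v::linorder set set \<Rightarrow> int \<Rightarrow> bool" where
  "homology_zero _ \<Delta> i \<longleftrightarrow>
     (reduced_homology \<Delta> i :: ('v set \<Rightarrow> 'k) set set) = {homology_class \<Delta> i (\<lambda>_. 0)}"

text \<open>
  Isomorphism with the ground field as a vector space; the operations on the quotient are those
  induced by the pointwise operations on cycles.
\<close>

definition homology_iso_field :: "'k::field itself \<Rightarrow> 'v::linorder set set \<Rightarrow> int \<Rightarrow> bool" where
  "homology_iso_field _ \<Delta> i \<longleftrightarrow>
     (\<exists>\<phi> :: ('v set \<Rightarrow> 'k) set \<Rightarrow> 'k.
        bij_betw \<phi> (reduced_homology \<Delta> i) UNIV \<and>
        (\<forall>x \<in> cycles \<Delta> i. \<forall>y \<in> cycles \<Delta> i.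
           \<phi> (homology_class \<Delta> i (\<lambda>\<sigma>. x \<sigma> + y \<sigma>)) =
           \<phi> (homology_class \<Delta> i x) + \<phi> (homology_class \<Delta> i y)) \<and>
        (\<forall>a. \<forall>x \<in> cycles \<Delta> i.
           \<phi> (homology_class \<Delta> i (\<lambda>\<sigma>. a * x \<sigma>)) = a * \<phi> (homology_class \<Delta> i x)))"

section \<open>Flag homology spheres and the types of their skeleta\<close>

text \<open>The parameter \<open>d\<close> is one more than the dimension of the sphere.\<close>

definition homology_sphere :: "'k::field itself \<Rightarrow> nat \<Rightarrow> 'v::linorder set set \<Rightarrow> bool" where
  "homology_sphere K d \<Delta> \<longleftrightarrow>
     simplicial_complex \<Delta> \<and> pure_of_rank d \<Delta> \<and>
     (\<forall>\<sigma>\<in>\<Delta>. \<forall>i.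
        (i < int d - 1 - int (card \<sigma>) \<longrightarrow> homology_zero K (link \<Delta> \<sigma>) i) \<and>
        (i = int d - 1 - int (card \<sigma>) \<longrightarrow> homology_iso_field K (link \<Delta> \<sigma>) i))"

definition gamma1 :: "nat \<Rightarrow> 'v set set \<Rightarrow> int" where
  "gamma1 d \<Delta> = int (card (vertices \<Delta>)) - 2 * int d"

definition complex_iso :: "'v set set \<Rightarrow> 'w set set \<Rightarrow> bool" where
  "complex_iso \<Delta> \<Gamma> \<longleftrightarrow>
     (\<exists>\<phi>. bij_betw \<phi> (vertices \<Delta>) (vertices \<Gamma>) \<and> (\<lambda>\<sigma>. \<phi> ` \<sigma>) ` \<Delta> = \<Gamma>)"

text \<open>Every finite complex is isomorphic to one whose vertices are natural numbers.\<close>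

definition flag_sphere_skeleta :: "'k::field itself \<Rightarrow> nat \<Rightarrow> nat \<Rightarrow> nat \<Rightarrow> nat set set set" where
  "flag_sphere_skeleta K b k d =
     {skeleton k \<Delta> | \<Delta>. homology_sphere K d \<Delta> \<and> flag \<Delta> \<and> gamma1 d \<Delta> = int b}"

definition skeleton_types :: "'k::field itself \<Rightarrow> nat \<Rightarrow> nat \<Rightarrow> nat \<Rightarrow> nat set set set set" where
  "skeleton_types K b k d =
     flag_sphere_skeleta K b k d //
       {(\<Delta>, \<Gamma>). \<Delta> \<in> flag_sphere_skeleta K b k d \<and> \<Gamma> \<in> flag_sphere_skeleta K b k d \<and>
                complex_iso \<Delta> \<Gamma>}"

definition num_skeleton_types :: "'k::field itself \<Rightarrow> nat \<Rightarrow> nat \<Rightarrow> nat \<Rightarrow> nat" where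
  "num_skeleton_types K b k d = card (skeleton_types K b k d)"

end

theory Submission
  imports Defs
begin

text \<open>
  Let \<open>R\<close> be the non-adjacency relation between the vertices of a flag homology sphere with
  \<open>2 d + b\<close> vertices. A link which is a cone has no homology in its top dimension, so no link is
  a cone: every vertex of a link has a non-neighbour in that link. Induction on \<open>d\<close> then gives
  at least \<open>2 d\<close> vertices, and applied to the link of a vertex this bounds its number of
  non-neighbours by \<open>b + 1\<close>. Call a vertex active if it has at least two non-neighbours.
  The number of active vertices is bounded in terms of \<open>b\<close> alone: the link of an active vertex \<open>v\<close>
  has smaller \<open>b\<close>, and a vertex of this link that is active in the sphere but not in
  the link is a non-neighbour of one of the at most \<open>b + 1\<close> non-neighbours of \<open>v\<close>.
  The inactive vertices are paired off by \<open>R\<close> (they form iterated suspensions), so the sphere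
  is determined up to isomorphism by \<open>d\<close>, \<open>b\<close> and the graph \<open>R\<close> on the active vertices.
\<close>

section \<open>The non-adjacency graph\<close>

locale nonadjacency =
  fixes R :: "'v \<Rightarrow> 'v \<Rightarrow> bool"
  assumes sym: "R u v \<Longrightarrow> R v u"
    and irrefl: "\<not> R v v"
begin

definition nonnbrs :: "'v set \<Rightarrow> 'v \<Rightarrow> 'v set" where
  "nonnbrs V v = {w \<in> V. R v w}"

definition nbrs :: "'v set \<Rightarrow> 'v \<Rightarrow> 'v set" where
  "nbrs V v = {w \<in> V. w \<noteq> v \<and> \<not> R v w}"

text \<open>The trace of a flag sphere in its graph: \<open>nbrs V v\<close> stands for the vertices
  of the link of \<open>v\<close>, and the clause on \<open>nonnbrs\<close> excludes cones.
  Nonemptiness keeps the empty set from being spherical for positive \<open>d\<close>.\<close>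

fun spherical :: "nat \<Rightarrow> 'v set \<Rightarrow> bool" where
  "spherical 0 V \<longleftrightarrow> V = {}"
| "spherical (Suc d) V \<longleftrightarrow>
     V \<noteq> {} \<and> (\<forall>v\<in>V. nonnbrs V v \<noteq> {} \<and> spherical d (nbrs V v))"

definition active :: "'v set \<Rightarrow> 'v set" where
  "active V = {v \<in> V. card (nonnbrs V v) \<ge> 2}"

lemma nonnbrs_nonempty: "spherical d V \<Longrightarrow> v \<in> V \<Longrightarrow> nonnbrs V v \<noteq> {}"
  by (cases d) auto

lemma finite_nonnbrs [simp]: "finite V \<Longrightarrow> finite (nonnbrs V v)"
  by (simp add: nonnbrs_def)

lemma finite_nbrs [simp]: "finite V \<Longrightarrow> finite (nbrs V v)"
  by (simp add: nbrs_def)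

lemma finite_active [simp]: "finite V \<Longrightarrow> finite (active V)"
  by (simp add: active_def)

lemma vertex_partition: "v \<in> V \<Longrightarrow> V = insert v (nonnbrs V v \<union> nbrs V v)"
  by (auto simp: nonnbrs_def nbrs_def)

lemma card_vertex_partition:
  assumes "finite V" "v \<in> V"
  shows "card V = 1 + card (nonnbrs V v) + card (nbrs V v)"
proof -
  have "card (insert v (nonnbrs V v \<union> nbrs V v)) = Suc (card (nonnbrs V v \<union> nbrs V v))"
    using assms irrefl by (intro card_insert_disjoint) (auto simp: nonnbrs_def nbrs_def)
  also have "card (nonnbrs V v \<union> nbrs V v) = card (nonnbrs V v) + card (nbrs V v)"
    using assms by (intro card_Un_disjoint) (auto simp: nonnbrs_def nbrs_def)
  finally show ?thesis
    using vertex_partition[OF assms(2)] by simp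
qed

section \<open>Vertex counts and degrees\<close>

text \<open>Passing to a link removes a vertex and at least one non-neighbour, so each of the
  \<open>d\<close> levels costs two vertices.\<close>

lemma spherical_card_ge: "finite V \<Longrightarrow> spherical d V \<Longrightarrow> 2 * d \<le> card V"
proof (induction d arbitrary: V)
  case (Suc d)
  then obtain v where v: "v \<in> V" "nonnbrs V v \<noteq> {}" "spherical d (nbrs V v)"
    by auto
  then have "card (nonnbrs V v) \<ge> 1"
    using Suc.prems(1) by (simp add: Suc_leI card_gt_0_iff)
  moreover have "2 * d \<le> card (nbrs V v)"
    using Suc.IH v(3) Suc.prems(1) by simp
  ultimately show ?case
    using card_vertex_partition[OF Suc.prems(1) v(1)] by simp
qed simp

text \<open>For positive \<open>d\<close> the link takes \<open>2 * (d - 1)\<close> vertices,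
  leaving at most \<open>b + 2\<close> for \<open>v\<close> and its non-neighbours together.\<close>

lemma card_nonnbrs_le:
  assumes "finite V" "spherical d V" "card V \<le> 2 * d + b" "v \<in> V"
  shows "card (nonnbrs V v) \<le> b + 1"
proof (cases d)
  case 0
  then show ?thesis using assms by simp
next
  case (Suc d')
  then have "2 * d' \<le> card (nbrs V v)"
    using assms by (intro spherical_card_ge) auto
  then show ?thesis
    using card_vertex_partition[OF assms(1,4)] assms(3) Suc by simp
qed

text \<open>In the link of a third vertex non-adjacent to \<open>w\<close>, \<open>v\<close> would be adjacent to everything.\<close>

lemma nonnbrs_singleton_sym:
  assumes "spherical d V" "v \<in> V" "nonnbrs V v = {w}"
  shows "nonnbrs V w = {v}"
proof -
  have w: "w \<in> V" "R v w" and only: "\<And>u. u \<in> V \<Longrightarrow> R v u \<Longrightarrow> u = w"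
    using assms(3) by (auto simp: nonnbrs_def)
  have "z = v" if z: "z \<in> V" "R w z" for z
  proof (rule ccontr)
    assume "z \<noteq> v"
    have "\<not> R z v"
      using only[of z] z sym irrefl by blast
    then have v: "v \<in> nbrs V z"
      using assms(2) \<open>z \<noteq> v\<close> by (simp add: nbrs_def)
    obtain d' where "spherical d' (nbrs V z)"
      using assms(1) z(1) by (cases d) auto
    then have "nonnbrs (nbrs V z) v \<noteq> {}"
      using v by (rule nonnbrs_nonempty)
    then show False
      using only z(2) sym by (force simp: nonnbrs_def nbrs_def)
  qed
  then show ?thesis
    using assms(2) sym[OF w(2)] unfolding nonnbrs_def by blast
qed

lemma inactive_nonnbrs:
  assumes "finite V" "spherical d V" "v \<in> V - active V"
  obtains w where "nonnbrs V v = {w}"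
proof -
  have "card (nonnbrs V v) < 2"
    using assms(3) by (auto simp: active_def)
  moreover have "card (nonnbrs V v) > 0"
    using assms nonnbrs_nonempty by (auto simp: card_gt_0_iff)
  ultimately have "card (nonnbrs V v) = 1" by simp
  then show ?thesis using that by (auto simp: card_1_singleton_iff)
qed

end

section \<open>Bounding the number of active vertices\<close>

text \<open>The summands for \<open>Suc b\<close> count an active vertex, its non-neighbours, the
  active vertices of its link, and the non-neighbours of its non-neighbours; \<open>b + 2\<close> is
  the degree bound at \<open>Suc b\<close>.\<close>

fun active_bound :: "nat \<Rightarrow> nat" where
  "active_bound 0 = 0"
| "active_bound (Suc b) = 1 + (b + 2) + active_bound b + (b + 2) * (b + 2)"

context nonadjacency
begin

lemma card_active_le:
  "finite V \<Longrightarrow> spherical d V \<Longrightarrow> card V \<le> 2 * d + b \<Longrightarrow> card (active V) \<le> active_bound b"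
proof (induction b arbitrary: d V)
  case 0
  \<comment> \<open>Without excess the degree bound is 1.\<close>
  then have "active V = {}"
    using card_nonnbrs_le[of V d 0] by (force simp: active_def)
  then show ?case by simp
next
  case (Suc b)
  show ?case
  proof (cases "active V = {}")
    case False
    then obtain v where v: "v \<in> V" "card (nonnbrs V v) \<ge> 2"
      by (auto simp: active_def)
    obtain d' where d': "d = Suc d'" "spherical d' (nbrs V v)"
      using Suc.prems(2) v(1) by (cases d) auto
    \<comment> \<open>At least three vertices disappear while \<open>2 * d\<close> drops by two, so
      the bound on the excess drops by one.\<close>
    have "card (nbrs V v) \<le> 2 * d' + b"
      using card_vertex_partition[OF Suc.prems(1) v(1)] v(2) d'(1) Suc.prems(3) by simp
    then have IH: "card (active (nbrs V v)) \<le> active_bound b"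
      using Suc.IH Suc.prems(1) d'(2) by simp
    have deg: "card (nonnbrs V u) \<le> b + 2" if "u \<in> V" for u
      using card_nonnbrs_le[OF Suc.prems that] by simp
    let ?U = "\<Union>u\<in>nonnbrs V v. nonnbrs V u"
    \<comment> \<open>Becoming inactive in the link means losing a non-neighbour \<open>u\<close>
      outside it; \<open>u\<close> is not \<open>v\<close>, which is adjacent to \<open>w\<close>,
      so \<open>u\<close> is a non-neighbour of \<open>v\<close>.\<close>
    have "w \<in> ?U" if w: "w \<in> active V" "w \<in> nbrs V v" "w \<notin> active (nbrs V v)" for w
    proof -
      have "nonnbrs V w \<noteq> nonnbrs (nbrs V v) w"
        using w by (auto simp: active_def)
      then obtain u where "u \<in> V" "R w u" "u \<notin> nbrs V v"
        by (auto simp: nonnbrs_def nbrs_def)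
      moreover have "u \<noteq> v"
        using w(2) \<open>R w u\<close> sym by (auto simp: nbrs_def)
      ultimately have "u \<in> nonnbrs V v" "w \<in> nonnbrs V u"
        using w(1) sym by (auto simp: nbrs_def nonnbrs_def active_def)
      then show ?thesis by blast
    qed
    moreover have "active V \<subseteq> insert v (nonnbrs V v \<union> nbrs V v)"
      using vertex_partition[OF v(1)] by (auto simp: active_def)
    ultimately have "active V \<subseteq> {v} \<union> nonnbrs V v \<union> active (nbrs V v) \<union> ?U"
      by blast
    then have "card (active V) \<le> card ({v} \<union> nonnbrs V v \<union> active (nbrs V v) \<union> ?U)"
      using Suc.prems(1) by (intro card_mono) auto
    also have "\<dots> \<le> card {v} + card (nonnbrs V v) + card (active (nbrs V v)) + card ?U"
      by (meson add_le_mono1 card_Un_le order_trans)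
    also have "card ?U \<le> (\<Sum>u\<in>nonnbrs V v. card (nonnbrs V u))"
      using Suc.prems(1) by (intro card_UN_le) simp
    also have "\<dots> \<le> card (nonnbrs V v) * (b + 2)"
      using deg sum_bounded_above[of "nonnbrs V v" "\<lambda>u. card (nonnbrs V u)" "b + 2"]
      by (auto simp: nonnbrs_def)
    also have "\<dots> \<le> (b + 2) * (b + 2)"
      using deg[OF v(1)] by (intro mult_right_mono) auto
    finally show ?thesis
      using IH deg[OF v(1)] by simp
  qed simp
qed

end

section \<open>Isomorphism from the graph on the active vertices\<close>

text \<open>Fixed-point-free involutions split their sets into two-element orbits, so only the
  number of orbits matters. The induction matches one orbit of \<open>p\<close> with one of
  \<open>q\<close> and removes both.\<close>

lemma involution_bij:
  assumes "finite I" "finite J" "card I = card J"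
    and "\<And>x. x \<in> I \<Longrightarrow> p x \<in> I \<and> p x \<noteq> x \<and> p (p x) = x"
    and "\<And>y. y \<in> J \<Longrightarrow> q y \<in> J \<and> q y \<noteq> y \<and> q (q y) = y"
  shows "\<exists>g. bij_betw g I J \<and> (\<forall>x\<in>I. g (p x) = q (g x))"
  using assms
proof (induction "card I" arbitrary: I J rule: less_induct)
  case less
  show ?case
  proof (cases "I = {}")
    case True
    then have "J = {}" using less.prems by simp
    then show ?thesis using True by (simp add: bij_betw_def)
  next
    case False
    then obtain x where x: "x \<in> I" by blast
    have "J \<noteq> {}" using False less.prems by auto
    then obtain y where y: "y \<in> J" by blast
    let ?I = "I - {x, p x}" and ?J = "J - {y, q y}"
    have px: "p x \<in> I" "p x \<noteq> x" "p (p x) = x" and qy: "q y \<in> J" "q y \<noteq> y" "q (q y) = y"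
      using less.prems(4)[OF x] less.prems(5)[OF y] by auto
    have card: "card ?I = card I - 2" "card ?J = card J - 2"
      using x y px qy by (simp_all add: card_Diff_subset)
    have "card ?I < card I"
      using x less.prems(1) by (intro psubset_card_mono) auto
    moreover have p': "p z \<in> ?I \<and> p z \<noteq> z \<and> p (p z) = z" if "z \<in> ?I" for z
      using less.prems(4)[of z] that px by (metis DiffD1 DiffD2 DiffI insert_iff singletonD)
    moreover have "q z \<in> ?J \<and> q z \<noteq> z \<and> q (q z) = z" if "z \<in> ?J" for z
      using less.prems(5)[of z] that qy by (metis DiffD1 DiffD2 DiffI insert_iff singletonD)
    moreover have "finite ?I" "finite ?J" "card ?I = card ?J"
      using less.prems(1-3) card by simp_all
    ultimately have "\<exists>g. bij_betw g ?I ?J \<and> (\<forall>z\<in>?I. g (p z) = q (g z))"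
      by (intro less.hyps)
    then obtain g where g: "bij_betw g ?I ?J" "\<And>z. z \<in> ?I \<Longrightarrow> g (p z) = q (g z)"
      by blast
    let ?h = "\<lambda>z. if z = x then y else if z = p x then q y else g z"
    have "bij_betw ?h {x, p x} {y, q y}"
      using px qy by (auto simp: bij_betw_def inj_on_def)
    moreover have "bij_betw ?h ?I ?J"
      using g(1) by (rule bij_betw_cong[THEN iffD1, rotated]) auto
    ultimately have "bij_betw ?h ({x, p x} \<union> ?I) ({y, q y} \<union> ?J)"
      by (rule bij_betw_combine) auto
    moreover have "{x, p x} \<union> ?I = I" "{y, q y} \<union> ?J = J"
      using x y px qy by auto
    moreover have "?h (p z) = q (?h z)" if "z \<in> I" for z
    proof (cases "z = x \<or> z = p x")
      case True
      then show ?thesis using px qy by (elim disjE) simp_all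
    next
      case False
      then have "z \<in> ?I" using that by simp
      then show ?thesis using False p'[of z] g(2)[of z] by simp
    qed
    ultimately have "bij_betw ?h I J \<and> (\<forall>z\<in>I. ?h (p z) = q (?h z))" by simp
    then show ?thesis by (rule exI[of _ ?h])
  qed
qed

context nonadjacency
begin

text \<open>By \<open>nonnbrs_singleton_sym\<close> the partner of \<open>x\<close> has
  \<open>x\<close> as its only non-neighbour, so it is inactive too.\<close>

lemma inactive_involution:
  assumes "finite V" "spherical d V"
  shows "\<exists>p. \<forall>x\<in>V - active V. nonnbrs V x = {p x} \<and> p x \<in> V - active V \<and> p x \<noteq> x \<and> p (p x) = x"
proof -
  define p where "p x = the_elem (nonnbrs V x)" for x
  have p: "nonnbrs V x = {p x}" if x: "x \<in> V - active V" for x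
    by (rule inactive_nonnbrs[OF assms x]) (simp add: p_def)
  have "p x \<in> V - active V \<and> p x \<noteq> x \<and> p (p x) = x" if x: "x \<in> V - active V" for x
  proof -
    have *: "nonnbrs V (p x) = {x}"
      using nonnbrs_singleton_sym assms(2) x p by blast
    have "p x \<in> nonnbrs V x" using p[OF x] by simp
    then have "p x \<in> V" "p x \<noteq> x" using irrefl by (auto simp: nonnbrs_def)
    moreover have "p x \<notin> active V" using * by (simp add: active_def)
    ultimately show ?thesis using p[of "p x"] * by simp
  qed
  then show ?thesis using p by (intro exI[of _ p]) simp
qed

end

text \<open>Outside the active part only the pairing has to be respected. Equal vertex counts leave
  equally many inactive vertices, so \<open>involution_bij\<close> applies.\<close>

lemma extend_active_iso:
  assumes "nonadjacency R" "nonadjacency R'"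
    and "finite V" "finite V'" "card V = card V'"
    and "nonadjacency.spherical R d V" "nonadjacency.spherical R' d V'"
    and f: "bij_betw f (nonadjacency.active R V) (nonadjacency.active R' V')"
      "\<And>u v. u \<in> nonadjacency.active R V \<Longrightarrow> v \<in> nonadjacency.active R V \<Longrightarrow>
         R u v \<longleftrightarrow> R' (f u) (f v)"
  obtains h where "bij_betw h V V'" "\<And>u v. u \<in> V \<Longrightarrow> v \<in> V \<Longrightarrow> R u v \<longleftrightarrow> R' (h u) (h v)"
proof -
  interpret R: nonadjacency R by fact
  interpret R': nonadjacency R' by fact
  let ?A = "R.active V" and ?A' = "R'.active V'"
  have A: "?A \<subseteq> V" "?A' \<subseteq> V'"
    by (auto simp: R.active_def R'.active_def)
  obtain p where p: "\<And>x. x \<in> V - ?A \<Longrightarrow>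
      R.nonnbrs V x = {p x} \<and> p x \<in> V - ?A \<and> p x \<noteq> x \<and> p (p x) = x"
    using R.inactive_involution[OF assms(3,6)] by blast
  obtain q where q: "\<And>x. x \<in> V' - ?A' \<Longrightarrow>
      R'.nonnbrs V' x = {q x} \<and> q x \<in> V' - ?A' \<and> q x \<noteq> x \<and> q (q x) = x"
    using R'.inactive_involution[OF assms(4,7)] by blast
  have "card (V - ?A) = card (V' - ?A')"
    using bij_betw_same_card[OF f(1)] assms(3-5) A by (simp add: card_Diff_subset finite_subset)
  then have "\<exists>g. bij_betw g (V - ?A) (V' - ?A') \<and> (\<forall>x\<in>V - ?A. g (p x) = q (g x))"
    using p q assms(3,4) by (intro involution_bij) blast+
  then obtain g where g: "bij_betw g (V - ?A) (V' - ?A')" "\<And>x. x \<in> V - ?A \<Longrightarrow> g (p x) = q (g x)"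
    by blast
  define h where "h x = (if x \<in> ?A then f x else g x)" for x
  have hA: "bij_betw h ?A ?A'"
    using f(1) by (rule bij_betw_cong[THEN iffD1, rotated]) (simp add: h_def)
  have hI: "bij_betw h (V - ?A) (V' - ?A')"
    using g(1) by (rule bij_betw_cong[THEN iffD1, rotated]) (simp add: h_def)
  have "bij_betw h (?A \<union> (V - ?A)) (?A' \<union> (V' - ?A'))"
    using hA hI by (rule bij_betw_combine) auto
  then have h: "bij_betw h V V'"
    using A by (simp add: Un_absorb1)
  \<comment> \<open>Being non-adjacent to an inactive \<open>u\<close> means being its partner,
    whether or not \<open>v\<close> is active. An inactive \<open>v\<close> is treated by symmetry
    below.\<close>
  have half: "R u v \<longleftrightarrow> R' (h u) (h v)" if uv: "u \<in> V - ?A" "v \<in> V" for u v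
  proof -
    have hu: "h u \<in> V' - ?A'" and hv: "h v \<in> V'"
      using uv hI h by (auto simp: bij_betw_def)
    have "R u v \<longleftrightarrow> v = p u"
      using p[OF uv(1)] uv(2) by (auto simp: R.nonnbrs_def)
    also have "\<dots> \<longleftrightarrow> h v = h (p u)"
      using h p[OF uv(1)] uv(2) by (auto simp: bij_betw_def inj_on_def)
    also have "h (p u) = q (h u)"
      using g(2)[OF uv(1)] p[OF uv(1)] uv(1) by (simp add: h_def)
    also have "h v = q (h u) \<longleftrightarrow> R' (h u) (h v)"
      using q[OF hu] hv by (auto simp: R'.nonnbrs_def)
    finally show ?thesis .
  qed
  have "R u v \<longleftrightarrow> R' (h u) (h v)" if uv: "u \<in> V" "v \<in> V" for u v
  proof (cases "u \<in> ?A \<and> v \<in> ?A")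
    case True
    then show ?thesis using f(2) by (simp add: h_def)
  next
    case False
    then show ?thesis
      using half[of u v] half[of v u] uv R.sym R'.sym by blast
  qed
  with h show ?thesis using that by blast
qed

section \<open>Flag complexes and homology spheres\<close>

definition nonadj :: "'v set set \<Rightarrow> 'v \<Rightarrow> 'v \<Rightarrow> bool" where
  "nonadj \<Delta> u v \<longleftrightarrow> u \<noteq> v \<and> {u, v} \<notin> \<Delta>"

lemma nonadjacency_nonadj [simp]: "nonadjacency (nonadj \<Delta>)"
  by unfold_locales (auto simp: nonadj_def insert_commute)

lemma finite_vertices: "simplicial_complex \<Delta> \<Longrightarrow> finite (vertices \<Delta>)"
  by (auto simp: simplicial_complex_def)

lemma face_subset: "simplicial_complex \<Delta> \<Longrightarrow> \<sigma> \<in> \<Delta> \<Longrightarrow> \<tau> \<subseteq> \<sigma> \<Longrightarrow> \<tau> \<in> \<Delta>"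
  by (auto simp: simplicial_complex_def)

section \<open>Flag complexes as clique complexes\<close>

text \<open>A smallest clique outside the complex would be a minimal non-face, so by flagness a
  non-adjacent pair, which is no clique.\<close>

lemma flag_face_iff:
  assumes "simplicial_complex \<Delta>" "flag \<Delta>"
  shows "\<sigma> \<in> \<Delta> \<longleftrightarrow> \<sigma> \<subseteq> vertices \<Delta> \<and> (\<forall>u\<in>\<sigma>. \<forall>v\<in>\<sigma>. \<not> nonadj \<Delta> u v)"
proof
  assume "\<sigma> \<in> \<Delta>"
  then show "\<sigma> \<subseteq> vertices \<Delta> \<and> (\<forall>u\<in>\<sigma>. \<forall>v\<in>\<sigma>. \<not> nonadj \<Delta> u v)"
    using face_subset[OF assms(1)] by (auto simp: nonadj_def)
next
  assume \<sigma>: "\<sigma> \<subseteq> vertices \<Delta> \<and> (\<forall>u\<in>\<sigma>. \<forall>v\<in>\<sigma>. \<not> nonadj \<Delta> u v)"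
  then have "finite \<sigma>"
    using finite_vertices[OF assms(1)] finite_subset by blast
  then show "\<sigma> \<in> \<Delta>" using \<sigma>
  proof (induction \<sigma> rule: finite_psubset_induct)
    case (psubset \<sigma>)
    show ?case
    proof (rule ccontr)
      assume "\<sigma> \<notin> \<Delta>"
      moreover have "\<tau> \<in> \<Delta>" if "\<tau> \<subset> \<sigma>" for \<tau>
        using psubset.IH[OF that] psubset.prems that by blast
      ultimately have "minimal_nonface \<Delta> \<sigma>"
        using psubset.prems by (auto simp: minimal_nonface_def)
      then have "card \<sigma> = 2"
        using assms(2) by (auto simp: flag_def)
      then obtain u v where "\<sigma> = {u, v}" "u \<noteq> v"
        by (auto simp: card_2_iff)
      then show False
        using psubset.prems \<open>\<sigma> \<notin> \<Delta>\<close> by (auto simp: nonadj_def)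
    qed
  qed
qed

section \<open>Pure complexes\<close>

lemma face_in_facet:
  assumes "simplicial_complex \<Delta>" "\<sigma> \<in> \<Delta>"
  obtains \<tau> where "facet \<Delta> \<tau>" "\<sigma> \<subseteq> \<tau>"
proof -
  have "finite \<Delta>" using assms(1) by (simp add: simplicial_complex_def)
  then obtain \<tau> where "\<tau> \<in> \<Delta>" "\<sigma> \<subseteq> \<tau>" "\<And>\<rho>. \<rho> \<in> \<Delta> \<Longrightarrow> \<tau> \<subseteq> \<rho> \<Longrightarrow> \<rho> = \<tau>"
    using finite_has_maximal2[OF _ assms(2)] by metis
  then show ?thesis using that[of \<tau>] by (simp add: facet_def)
qed

lemma pure_card_le:
  assumes "simplicial_complex \<Delta>" "pure_of_rank d \<Delta>" "\<sigma> \<in> \<Delta>"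
  shows "card \<sigma> \<le> d"
proof -
  obtain \<tau> where "facet \<Delta> \<tau>" "\<sigma> \<subseteq> \<tau>"
    using face_in_facet assms by blast
  moreover from this have "finite \<tau>" "card \<tau> = d"
    using assms by (auto simp: facet_def simplicial_complex_def pure_of_rank_def)
  ultimately show ?thesis using card_mono by blast
qed

lemma pure_extend:
  assumes "simplicial_complex \<Delta>" "pure_of_rank d \<Delta>" "\<sigma> \<in> \<Delta>" "card \<sigma> < d"
  obtains v where "v \<notin> \<sigma>" "insert v \<sigma> \<in> \<Delta>"
proof -
  obtain \<tau> where \<tau>: "facet \<Delta> \<tau>" "\<sigma> \<subseteq> \<tau>"
    using face_in_facet assms by blast
  then have "card \<tau> = d" "\<tau> \<in> \<Delta>"
    using assms(2) by (auto simp: facet_def pure_of_rank_def)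
  then have "\<not> \<tau> \<subseteq> \<sigma>"
    using \<tau>(2) assms(4) by auto
  then obtain v where "v \<in> \<tau>" "v \<notin> \<sigma>" by blast
  then show ?thesis
    using that face_subset[OF assms(1) \<open>\<tau> \<in> \<Delta>\<close>] \<tau>(2) by blast
qed

text \<open>
  If \<open>c\<close> is a cycle in the top dimension of a cone with apex \<open>a\<close>, every simplex in its support
  contains \<open>a\<close>, and the boundary of \<open>c\<close> at \<open>\<sigma> - {a}\<close> has the single term \<open>c \<sigma>\<close> up to sign.
\<close>

lemma top_homology_cone:
  fixes \<Lambda> :: "'v::linorder set set"
  assumes fin: "finite (vertices \<Lambda>)" and fin': "\<And>\<tau>. \<tau> \<in> \<Lambda> \<Longrightarrow> finite \<tau>"
    and dim: "\<And>\<tau>. \<tau> \<in> \<Lambda> \<Longrightarrow> int (card \<tau>) \<le> i + 1"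
    and cone: "\<And>\<tau>. \<tau> \<in> \<Lambda> \<Longrightarrow> insert a \<tau> \<in> \<Lambda>"
  shows "\<not> homology_iso_field TYPE('k::field) \<Lambda> i"
proof
  have zero: "c = (\<lambda>_. 0)" if c: "c \<in> cycles \<Lambda> i" for c :: "'v set \<Rightarrow> 'k"
  proof
    fix \<sigma>
    have apex: "a \<in> \<sigma>" if "c \<sigma> \<noteq> 0" for \<sigma>
    proof (rule ccontr)
      assume "a \<notin> \<sigma>"
      have "\<sigma> \<in> \<Lambda>" "int (card \<sigma>) = i + 1"
        using c that by (auto simp: cycles_def chains_def)
      \<comment> \<open>Adding \<open>a\<close> to \<sigma> would give a face of size
        \<open>i + 2\<close>, above the top dimension.\<close>
      then show False
        using dim[OF cone[of \<sigma>]] fin'[of \<sigma>] \<open>a \<notin> \<sigma>\<close> by simp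
    qed
    show "c \<sigma> = 0"
    proof (rule ccontr)
      assume nz: "c \<sigma> \<noteq> 0"
      then have a: "a \<in> \<sigma>" and \<sigma>: "\<sigma> \<in> \<Lambda>"
        using apex c by (auto simp: cycles_def chains_def)
      let ?\<tau> = "\<sigma> - {a}" and ?s = "\<lambda>v. (-1) ^ card {w \<in> \<sigma> - {a}. w < v} :: 'k"
      have "0 = boundary \<Lambda> c ?\<tau>"
        using c by (simp add: cycles_def)
      also have "\<dots> = (\<Sum>v\<in>vertices \<Lambda> - ?\<tau>. if v = a then ?s a * c \<sigma> else 0)"
        unfolding boundary_def
      proof (rule sum.cong)
        fix v assume "v \<in> vertices \<Lambda> - ?\<tau>"
        show "?s v * c (insert v ?\<tau>) = (if v = a then ?s a * c \<sigma> else 0)"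
          using apex[of "insert v ?\<tau>"] a by (auto simp: insert_absorb)
      qed simp
      also have "\<dots> = ?s a * c \<sigma>"
        using fin a \<sigma> by (auto simp: sum.delta)
      finally show False using nz by simp
    qed
  qed
  assume "homology_iso_field TYPE('k) \<Lambda> i"
  then obtain \<phi> :: "('v set \<Rightarrow> 'k) set \<Rightarrow> 'k" where "bij_betw \<phi> (reduced_homology \<Lambda> i) UNIV"
    by (auto simp: homology_iso_field_def)
  then have UNIV: "(UNIV :: 'k set) = \<phi> ` homology_class \<Lambda> i ` cycles \<Lambda> i"
    by (simp add: bij_betw_def reduced_homology_def)
  \<comment> \<open>As 0 is the only cycle, all homology classes agree and the field would have a
    single element.\<close>
  have "x = y" for x y :: 'k
  proof -
    have "x \<in> \<phi> ` homology_class \<Lambda> i ` cycles \<Lambda> i" "y \<in> \<phi> ` homology_class \<Lambda> i ` cycles \<Lambda> i"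
      using UNIV by blast+
    then show ?thesis
      using zero by blast
  qed
  then show False
    using zero_neq_one[where 'a = 'k] by blast
qed

section \<open>From flag spheres to the graph condition\<close>

text \<open>The links of all faces are treated together, by induction on
  \<open>n = d - card \<sigma>\<close> starting from faces of full size; the empty face gives the
  whole sphere.\<close>

lemma flag_sphere_spherical:
  fixes \<Delta> :: "'v::linorder set set"
  assumes S: "homology_sphere TYPE('k::field) d \<Delta>" and F: "flag \<Delta>"
  shows "nonadjacency.spherical (nonadj \<Delta>) d (vertices \<Delta>)"
proof -
  interpret nonadjacency "nonadj \<Delta>" by simp
  have C: "simplicial_complex \<Delta>" and P: "pure_of_rank d \<Delta>"
    using S by (auto simp: homology_sphere_def)
  \<comment> \<open>The vertex set of the link of a face \<sigma>; indexing by faces avoids iterated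
    links.\<close>
  define W where "W \<sigma> = {v. v \<notin> \<sigma> \<and> insert v \<sigma> \<in> \<Delta>}" for \<sigma>
  have insert_face: "insert v \<sigma> \<in> \<Delta>"
    if "\<sigma> \<in> \<Delta>" "v \<in> vertices \<Delta>" "\<And>u. u \<in> \<sigma> \<Longrightarrow> \<not> nonadj \<Delta> v u" for v \<sigma>
    using that sym irrefl unfolding flag_face_iff[OF C F] by blast
  have not_nonadj: "\<not> nonadj \<Delta> u v" if "\<sigma> \<in> \<Delta>" "u \<in> \<sigma>" "v \<in> \<sigma>" for u v \<sigma>
    using that flag_face_iff[OF C F] by blast
  \<comment> \<open>Otherwise flagness makes the link a cone with apex \<open>v\<close>, against
    \<open>top_homology_cone\<close>.\<close>
  have nonnbr: "nonnbrs (W \<sigma>) v \<noteq> {}" if \<sigma>: "\<sigma> \<in> \<Delta>" and v: "v \<in> W \<sigma>" for \<sigma> v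
  proof
    assume empty: "nonnbrs (W \<sigma>) v = {}"
    have V: "v \<notin> \<sigma>" "insert v \<sigma> \<in> \<Delta>" "v \<in> vertices \<Delta>"
      using v by (auto simp: W_def)
    have "insert v \<tau> \<in> link \<Delta> \<sigma>" if \<tau>: "\<tau> \<in> link \<Delta> \<sigma>" for \<tau>
    proof -
      have T: "\<tau> \<inter> \<sigma> = {}" "\<tau> \<union> \<sigma> \<in> \<Delta>"
        using \<tau> by (auto simp: link_def)
      have "\<not> nonadj \<Delta> v u" if u: "u \<in> \<tau> \<union> \<sigma>" for u
      proof (cases "u \<in> \<sigma>")
        case True
        then show ?thesis using not_nonadj[OF V(2)] by blast
      next
        case False
        then have "insert u \<sigma> \<in> \<Delta>"
          using face_subset[OF C T(2)] u by blast
        then show ?thesis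
          using empty False by (auto simp: W_def nonnbrs_def)
      qed
      then have "insert v (\<tau> \<union> \<sigma>) \<in> \<Delta>"
        using insert_face T(2) V(3) by blast
      moreover from this have "insert v \<tau> \<in> \<Delta>"
        by (rule face_subset[OF C]) blast
      ultimately show ?thesis
        using V(1) T(1) by (simp add: link_def)
    qed
    \<comment> \<open>Purity puts the degree with nonzero homology at the top of the link.\<close>
    moreover have "int (card \<tau>) \<le> (int d - 1 - int (card \<sigma>)) + 1" if "\<tau> \<in> link \<Delta> \<sigma>" for \<tau>
    proof -
      have "card (\<tau> \<union> \<sigma>) \<le> d" "card (\<tau> \<union> \<sigma>) = card \<tau> + card \<sigma>"
        using that \<sigma> C pure_card_le[OF C P]
        by (auto simp: link_def simplicial_complex_def intro!: card_Un_disjoint)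
      then show ?thesis by simp
    qed
    moreover have "finite (vertices (link \<Delta> \<sigma>))" "\<And>\<tau>. \<tau> \<in> link \<Delta> \<sigma> \<Longrightarrow> finite \<tau>"
      using C by (auto simp: link_def simplicial_complex_def)
    ultimately have "\<not> homology_iso_field TYPE('k) (link \<Delta> \<sigma>) (int d - 1 - int (card \<sigma>))"
      by (intro top_homology_cone) auto
    then show False
      using S \<sigma> by (auto simp: homology_sphere_def)
  qed
  \<comment> \<open>By flagness, a vertex that extends \<sigma> and is adjacent to \<open>v\<close>
    extends \<open>insert v \<sigma>\<close>.\<close>
  have nbrs: "nbrs (W \<sigma>) v = W (insert v \<sigma>)" if \<sigma>: "\<sigma> \<in> \<Delta>" and v: "v \<in> W \<sigma>" for \<sigma> v
  proof (intro set_eqI iffI)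
    fix u assume "u \<in> nbrs (W \<sigma>) v"
    then have u: "u \<notin> \<sigma>" "insert u \<sigma> \<in> \<Delta>" "u \<noteq> v" "\<not> nonadj \<Delta> v u"
      by (auto simp: nbrs_def W_def)
    have "insert u (insert v \<sigma>) \<in> \<Delta>"
    proof (rule insert_face)
      show "insert v \<sigma> \<in> \<Delta>" using v by (simp add: W_def)
      show "u \<in> vertices \<Delta>" using u(2) by blast
      show "\<not> nonadj \<Delta> u w" if "w \<in> insert v \<sigma>" for w
        using that not_nonadj[OF u(2)] u(4) sym by blast
    qed
    then show "u \<in> W (insert v \<sigma>)"
      using u by (simp add: W_def)
  next
    fix u assume "u \<in> W (insert v \<sigma>)"
    then have u: "u \<notin> \<sigma>" "u \<noteq> v" "insert u (insert v \<sigma>) \<in> \<Delta>"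
      by (auto simp: W_def)
    then have "insert u \<sigma> \<in> \<Delta>" "\<not> nonadj \<Delta> v u"
      using face_subset[OF C u(3)] not_nonadj[OF u(3)] by blast+
    then show "u \<in> nbrs (W \<sigma>) v"
      using u by (simp add: W_def nbrs_def)
  qed
  have "spherical n (W \<sigma>)" if "\<sigma> \<in> \<Delta>" "card \<sigma> + n = d" for n \<sigma>
    using that
  proof (induction n arbitrary: \<sigma>)
    case 0
    have "finite \<sigma>" using 0 C by (auto simp: simplicial_complex_def)
    then show ?case
      using pure_card_le[OF C P] 0 by (force simp: W_def)
  next
    case (Suc n)
    have fin: "finite \<sigma>" using Suc.prems C by (auto simp: simplicial_complex_def)
    have "card \<sigma> < d" using Suc.prems(2) by simp
    then obtain v where "v \<notin> \<sigma>" "insert v \<sigma> \<in> \<Delta>"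
      using pure_extend[OF C P Suc.prems(1)] by blast
    then have "W \<sigma> \<noteq> {}" by (auto simp: W_def)
    moreover have "spherical n (nbrs (W \<sigma>) v)" if v: "v \<in> W \<sigma>" for v
    proof -
      have "insert v \<sigma> \<in> \<Delta>" "card (insert v \<sigma>) + n = d"
        using v fin Suc.prems(2) by (simp_all add: W_def)
      then show ?thesis
        using Suc.IH nbrs[OF Suc.prems(1) v] by simp
    qed
    ultimately show ?case
      using nonnbr[OF Suc.prems(1)] by simp
  qed
  moreover have "{} \<in> \<Delta>" using C by (simp add: simplicial_complex_def)
  moreover have "W {} = vertices \<Delta>"
    using face_subset[OF C] by (auto simp: W_def)
  ultimately show ?thesis by (metis add_0 card.empty)
qed

section \<open>Counting types\<close>

lemma complex_iso_sym: "complex_iso \<Delta> \<Gamma> \<Longrightarrow> complex_iso \<Gamma> \<Delta>"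
proof -
  assume "complex_iso \<Delta> \<Gamma>"
  then obtain \<phi> where \<phi>: "bij_betw \<phi> (vertices \<Delta>) (vertices \<Gamma>)" "(\<lambda>\<sigma>. \<phi> ` \<sigma>) ` \<Delta> = \<Gamma>"
    by (auto simp: complex_iso_def)
  let ?\<psi> = "inv_into (vertices \<Delta>) \<phi>"
  have inv: "?\<psi> ` \<phi> ` \<sigma> = \<sigma>" if "\<sigma> \<in> \<Delta>" for \<sigma>
    using that \<phi>(1) by (intro inv_into_image_cancel) (auto simp: bij_betw_def)
  have "(\<lambda>\<sigma>. ?\<psi> ` \<sigma>) ` \<Gamma> = (\<lambda>\<sigma>. ?\<psi> ` \<phi> ` \<sigma>) ` \<Delta>"
    unfolding \<phi>(2)[symmetric] image_image ..
  also have "\<dots> = \<Delta>" using inv by simp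
  finally show ?thesis
    using bij_betw_inv_into[OF \<phi>(1)] by (auto simp: complex_iso_def)
qed

lemma complex_iso_trans:
  assumes "complex_iso \<Delta> \<Gamma>" "complex_iso \<Gamma> \<Theta>"
  shows "complex_iso \<Delta> \<Theta>"
proof -
  obtain \<phi> \<psi> where "bij_betw \<phi> (vertices \<Delta>) (vertices \<Gamma>)" "(\<lambda>\<sigma>. \<phi> ` \<sigma>) ` \<Delta> = \<Gamma>"
    "bij_betw \<psi> (vertices \<Gamma>) (vertices \<Theta>)" "(\<lambda>\<sigma>. \<psi> ` \<sigma>) ` \<Gamma> = \<Theta>"
    using assms unfolding complex_iso_def by blast
  then have "bij_betw (\<psi> \<circ> \<phi>) (vertices \<Delta>) (vertices \<Theta>)" "(\<lambda>\<sigma>. (\<psi> \<circ> \<phi>) ` \<sigma>) ` \<Delta> = \<Theta>"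
    using bij_betw_trans by (blast, auto simp: image_comp)
  then show ?thesis unfolding complex_iso_def by blast
qed

text \<open>Singletons survive the truncation, as \<open>k + 1\<close> is at least 1.\<close>

lemma vertices_skeleton:
  assumes "simplicial_complex \<Delta>"
  shows "vertices (skeleton k \<Delta>) = vertices \<Delta>"
proof -
  have "{v} \<in> skeleton k \<Delta>" if "v \<in> \<sigma>" "\<sigma> \<in> \<Delta>" for v \<sigma>
    using that face_subset[OF assms] by (auto simp: skeleton_def)
  then show ?thesis by (fastforce simp: skeleton_def)
qed

text \<open>The faces are the cliques, which \<open>h\<close> carries over in both directions, and
  injectivity preserves the sizes at which skeleta are cut off.\<close>

lemma skeleton_iso:
  assumes "simplicial_complex \<Delta>" "flag \<Delta>" "simplicial_complex \<Gamma>" "flag \<Gamma>"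
    and h: "bij_betw h (vertices \<Delta>) (vertices \<Gamma>)"
      "\<And>u v. u \<in> vertices \<Delta> \<Longrightarrow> v \<in> vertices \<Delta> \<Longrightarrow> nonadj \<Delta> u v \<longleftrightarrow> nonadj \<Gamma> (h u) (h v)"
  shows "complex_iso (skeleton k \<Delta>) (skeleton k \<Gamma>)"
proof -
  have inj: "inj_on h \<sigma>" if "\<sigma> \<subseteq> vertices \<Delta>" for \<sigma>
    using h(1) that inj_on_subset by (auto simp: bij_betw_def)
  have iff: "h ` \<sigma> \<in> skeleton k \<Gamma> \<longleftrightarrow> \<sigma> \<in> skeleton k \<Delta>" if s: "\<sigma> \<subseteq> vertices \<Delta>" for \<sigma>
  proof -
    have "h ` \<sigma> \<subseteq> vertices \<Gamma>"
      using image_mono[OF s, of h] h(1) by (simp add: bij_betw_def)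
    moreover have "nonadj \<Gamma> (h u) (h v) \<longleftrightarrow> nonadj \<Delta> u v" if "u \<in> \<sigma>" "v \<in> \<sigma>" for u v
      using h(2)[of u v] s that by blast
    ultimately have "h ` \<sigma> \<in> \<Gamma> \<longleftrightarrow> \<sigma> \<in> \<Delta>"
      using s flag_face_iff[OF assms(1,2), of \<sigma>] flag_face_iff[OF assms(3,4), of "h ` \<sigma>"] by auto
    then show ?thesis
      using card_image[OF inj[OF s]] by (simp add: skeleton_def)
  qed
  have "(\<lambda>\<sigma>. h ` \<sigma>) ` skeleton k \<Delta> = skeleton k \<Gamma>"
  proof (intro equalityI subsetI)
    fix \<tau> assume "\<tau> \<in> (\<lambda>\<sigma>. h ` \<sigma>) ` skeleton k \<Delta>"
    then obtain \<sigma> where \<sigma>: "\<sigma> \<in> skeleton k \<Delta>" "\<tau> = h ` \<sigma>" by blast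
    then have "\<sigma> \<subseteq> vertices \<Delta>" by (auto simp: skeleton_def)
    then show "\<tau> \<in> skeleton k \<Gamma>" using iff \<sigma> by blast
  next
    fix \<tau> assume \<tau>: "\<tau> \<in> skeleton k \<Gamma>"
    then have "\<tau> \<subseteq> h ` vertices \<Delta>"
      using h(1) by (auto simp: skeleton_def bij_betw_def)
    then obtain \<sigma> where "\<sigma> \<subseteq> vertices \<Delta>" "\<tau> = h ` \<sigma>"
      by (auto simp: subset_image_iff)
    then show "\<tau> \<in> (\<lambda>\<sigma>. h ` \<sigma>) ` skeleton k \<Delta>"
      using iff \<tau> by blast
  qed
  then show ?thesis
    using h(1) assms(1,3) by (auto simp: complex_iso_def vertices_skeleton)
qed

section \<open>Counting classes by codes\<close>

text \<open>One representative is chosen per code. \<open>Q\<close> is a relation because an element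
  may have several codes.\<close>

lemma quotient_card_le:
  assumes "finite S"
    and code: "\<And>x. x \<in> F \<Longrightarrow> \<exists>s\<in>S. Q x s"
    and same: "\<And>x y s. x \<in> F \<Longrightarrow> y \<in> F \<Longrightarrow> Q x s \<Longrightarrow> Q y s \<Longrightarrow> r `` {x} = r `` {y}"
  shows "finite (F // r) \<and> card (F // r) \<le> card S"
proof -
  \<comment> \<open>At a code of no element the choice is arbitrary, which is harmless: the image of
    \<open>g\<close> only has to cover the quotient.\<close>
  define g where "g s = r `` {SOME x. x \<in> F \<and> Q x s}" for s
  have "F // r \<subseteq> g ` S"
  proof
    fix X assume "X \<in> F // r"
    then obtain x where x: "x \<in> F" "X = r `` {x}"
      by (auto simp: quotient_def)
    then obtain s where s: "s \<in> S" "Q x s" using code by blast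
    have "(SOME x. x \<in> F \<and> Q x s) \<in> F \<and> Q (SOME x. x \<in> F \<and> Q x s) s"
      using x s by (intro someI[of "\<lambda>x. x \<in> F \<and> Q x s" x]) simp
    then have "X = g s"
      using same x s unfolding g_def by blast
    then show "X \<in> g ` S" using s by blast
  qed
  then show ?thesis
    using assms(1) by (meson card_image_le card_mono finite_imageI finite_subset order_trans)
qed

text \<open>
  The pair \<open>s\<close> records the number of active vertices and, for some numbering of them,
  the graph of non-adjacent pairs.
\<close>

definition has_code :: "'v set set \<Rightarrow> nat \<times> (nat \<times> nat) set \<Rightarrow> bool" where
  "has_code \<Delta> s \<longleftrightarrow>
     (\<exists>h. bij_betw h (nonadjacency.active (nonadj \<Delta>) (vertices \<Delta>)) {..<fst s} \<and>
        snd s = {(h u, h v) | u v. u \<in> nonadjacency.active (nonadj \<Delta>) (vertices \<Delta>) \<and>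
          v \<in> nonadjacency.active (nonadj \<Delta>) (vertices \<Delta>) \<and> nonadj \<Delta> u v})"

text \<open>The count is at most \<open>C\<close> and the numbers are below it, so the codes lie in
  a finite set fixed by \<open>C\<close>.\<close>

lemma has_code_exists:
  assumes "simplicial_complex \<Delta>"
    and le: "card (nonadjacency.active (nonadj \<Delta>) (vertices \<Delta>)) \<le> C"
  shows "\<exists>s\<in>{..C} \<times> Pow ({..<C} \<times> {..<C}). has_code \<Delta> s"
proof -
  interpret nonadjacency "nonadj \<Delta>" by simp
  let ?A = "active (vertices \<Delta>)"
  have "finite ?A" using finite_vertices[OF assms(1)] by simp
  then obtain h where h: "bij_betw h ?A {..<card ?A}"
    using ex_bij_betw_finite_nat lessThan_atLeast0 by metis
  let ?E = "{(h u, h v) | u v. u \<in> ?A \<and> v \<in> ?A \<and> nonadj \<Delta> u v}"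
  have "h u < C" if "u \<in> ?A" for u
    using bij_betwE[OF h] that le by fastforce
  then have "(card ?A, ?E) \<in> {..C} \<times> Pow ({..<C} \<times> {..<C})"
    using le by auto
  moreover have "has_code \<Delta> (card ?A, ?E)"
    unfolding has_code_def using h by auto
  ultimately show ?thesis by blast
qed

text \<open>A common code identifies the two graphs on active vertices;
  \<open>extend_active_iso\<close> then adds the inactive pairs.\<close>

lemma has_code_skeleton_iso:
  fixes \<Delta> \<Gamma> :: "'v::linorder set set"
  assumes D: "homology_sphere TYPE('k::field) d \<Delta>" "flag \<Delta>"
    and G: "homology_sphere TYPE('k) d \<Gamma>" "flag \<Gamma>"
    and card: "card (vertices \<Delta>) = card (vertices \<Gamma>)"
    and code: "has_code \<Delta> s" "has_code \<Gamma> s"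
  shows "complex_iso (skeleton k \<Delta>) (skeleton k \<Gamma>)"
proof -
  interpret D: nonadjacency "nonadj \<Delta>" by simp
  interpret G: nonadjacency "nonadj \<Gamma>" by simp
  have C: "simplicial_complex \<Delta>" "simplicial_complex \<Gamma>"
    using D G by (auto simp: homology_sphere_def)
  let ?A = "D.active (vertices \<Delta>)" and ?B = "G.active (vertices \<Gamma>)"
  obtain h where h: "bij_betw h ?A {..<fst s}"
    "snd s = {(h u, h v) | u v. u \<in> ?A \<and> v \<in> ?A \<and> nonadj \<Delta> u v}"
    using code(1) by (auto simp: has_code_def)
  obtain g where g: "bij_betw g ?B {..<fst s}"
    "snd s = {(g u, g v) | u v. u \<in> ?B \<and> v \<in> ?B \<and> nonadj \<Gamma> u v}"
    using code(2) by (auto simp: has_code_def)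
  have h_edge: "nonadj \<Delta> u v \<longleftrightarrow> (h u, h v) \<in> snd s" if "u \<in> ?A" "v \<in> ?A" for u v
    using h(1) that unfolding h(2) bij_betw_def inj_on_def by blast
  have g_edge: "nonadj \<Gamma> u v \<longleftrightarrow> (g u, g v) \<in> snd s" if "u \<in> ?B" "v \<in> ?B" for u v
    using g(1) that unfolding g(2) bij_betw_def inj_on_def by blast
  \<comment> \<open>Active vertices with the same number are matched.\<close>
  define f where "f = inv_into ?B g \<circ> h"
  have f: "bij_betw f ?A ?B"
    unfolding f_def using h(1) bij_betw_inv_into[OF g(1)] by (rule bij_betw_trans)
  have gf: "g (f u) = h u" if "u \<in> ?A" for u
    using bij_betw_inv_into_right[OF g(1)] bij_betwE[OF h(1)] that by (simp add: f_def)
  have "nonadj \<Delta> u v \<longleftrightarrow> nonadj \<Gamma> (f u) (f v)" if "u \<in> ?A" "v \<in> ?A" for u v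
    using h_edge[OF that] g_edge[of "f u" "f v"] bij_betwE[OF f] gf that by simp
  then obtain \<phi> where "bij_betw \<phi> (vertices \<Delta>) (vertices \<Gamma>)"
    "\<And>u v. u \<in> vertices \<Delta> \<Longrightarrow> v \<in> vertices \<Delta> \<Longrightarrow> nonadj \<Delta> u v \<longleftrightarrow> nonadj \<Gamma> (\<phi> u) (\<phi> v)"
    using extend_active_iso[of "nonadj \<Delta>" "nonadj \<Gamma>" "vertices \<Delta>" "vertices \<Gamma>" d f]
      finite_vertices[OF C(1)] finite_vertices[OF C(2)] card f
      flag_sphere_spherical[OF D] flag_sphere_spherical[OF G] by auto
  then show ?thesis
    using skeleton_iso C D(2) G(2) by blast
qed

theorem theorem4p4:
  fixes b k :: nat
  assumes "k \<ge> 1"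
  shows "\<exists>c::nat. \<forall>d\<ge>1.
           finite (skeleton_types TYPE('k::field) b k d) \<and>
           num_skeleton_types TYPE('k) b k d \<le> c"
proof (intro exI allI impI)
  fix d :: nat
  \<comment> \<open>The range of codes depends on \<open>b\<close> alone, so \<open>card ?S\<close>
    serves as the constant for every \<open>d\<close>.\<close>
  let ?S = "{..active_bound b} \<times> Pow ({..<active_bound b} \<times> {..<active_bound b})"
  let ?F = "flag_sphere_skeleta TYPE('k) b k d"
  let ?r = "{(\<Delta>, \<Gamma>). \<Delta> \<in> ?F \<and> \<Gamma> \<in> ?F \<and> complex_iso \<Delta> \<Gamma>}"
  let ?sph = "\<lambda>\<Delta> :: nat set set. homology_sphere TYPE('k) d \<Delta> \<and> flag \<Delta> \<and> gamma1 d \<Delta> = int b"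
  \<comment> \<open>The code is read off a flag sphere whose skeleton is \<open>X\<close>.\<close>
  let ?Q = "\<lambda>X s. \<exists>\<Delta>. X = skeleton k \<Delta> \<and> ?sph \<Delta> \<and> has_code \<Delta> s"
  have "finite (?F // ?r) \<and> card (?F // ?r) \<le> card ?S"
  proof (rule quotient_card_le[where Q = ?Q])
    show "finite ?S" by simp
  next
    fix X assume "X \<in> ?F"
    then obtain \<Delta> where \<Delta>: "X = skeleton k \<Delta>" "?sph \<Delta>"
      by (auto simp: flag_sphere_skeleta_def)
    then have C: "simplicial_complex \<Delta>" by (simp add: homology_sphere_def)
    have "card (vertices \<Delta>) \<le> 2 * d + b"
      using \<Delta>(2) by (simp add: gamma1_def)
    moreover have "nonadjacency.spherical (nonadj \<Delta>) d (vertices \<Delta>)"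
      using \<Delta>(2) flag_sphere_spherical by blast
    ultimately have "card (nonadjacency.active (nonadj \<Delta>) (vertices \<Delta>)) \<le> active_bound b"
      using nonadjacency.card_active_le[OF nonadjacency_nonadj finite_vertices[OF C]] by blast
    then obtain s where "s \<in> ?S" "has_code \<Delta> s"
      using has_code_exists[OF C] by blast
    then show "\<exists>s\<in>?S. ?Q X s"
      using \<Delta> by (intro bexI[of _ s] exI[of _ \<Delta>] conjI) simp_all
  next
    fix X Y s assume XY: "X \<in> ?F" "Y \<in> ?F" and "?Q X s" "?Q Y s"
    then obtain \<Delta> \<Gamma> where "X = skeleton k \<Delta>" "?sph \<Delta>" "has_code \<Delta> s"
      "Y = skeleton k \<Gamma>" "?sph \<Gamma>" "has_code \<Gamma> s"
      by blast
    \<comment> \<open>Equal \<open>gamma1\<close> at the same \<open>d\<close> gives equal vertex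
      counts.\<close>
    then have XY_iso: "complex_iso X Y"
      using has_code_skeleton_iso[where 'k = 'k, of d \<Delta> \<Gamma> s k] by (simp add: gamma1_def)
    have "complex_iso X Z \<longleftrightarrow> complex_iso Y Z" for Z :: "nat set set"
      using complex_iso_trans[OF XY_iso] complex_iso_trans[OF complex_iso_sym[OF XY_iso]]
      by (rule iffI[rotated])
    then show "?r `` {X} = ?r `` {Y}"
      using XY by auto
  qed
  then show "finite (skeleton_types TYPE('k) b k d) \<and> num_skeleton_types TYPE('k) b k d \<le> card ?S"
    by (simp add: skeleton_types_def num_skeleton_types_def)
qed

end
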